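(* Let $\mathbb{V}$ be an $n$-dimensional vector space over a finite field $\mathbb{F}$ with $q$ elements, and let $\Gamma(\mathbb{V})$ be its non-zero component graph. If $q=2$ and $n\geq 3$, then the exchange property does not hold in $\Gamma(\mathbb{V})$.
   Context: The non-zero component graph $\Gamma(\mathbb{V})$ with respect to a basis $\{\alpha_1,\ldots,\alpha_n\}$ of $\mathbb{V}$ is the simple graph whose vertices are the non-zero vectors of $\mathbb{V}$; two distinct vertices are joined by an edge if there is at least one $\alpha_i$ having non-zero coefficient in the basis expansions of both of them (up to isomorphism the graph does not depend on the basis). In a finite simple connected graph $\Gamma$, $d(u,v)$ is the length of a shortest path between $u$ and $v$. A set $W=\{w_1,\ldots,w_k\}$ of vertices is a resolving set if distinct vertices $v$ of $\Gamma$ have distinct representations $r(v|W)=(d(v,w_1),\ldots,d(v,w_k))$. A resolving set $W$ of cardinality $k$ is minimal if it does not contain a resolving set of cardinality $k-1$ as a proper subset. The exchange property (for resolving sets) holds in $\Gamma$ if whenever $W_1$ and $W_2$ are minimal resolving sets for $\Gamma$ and $r\in W_1$, there exists $s\in W_2$ such that $(W_2\setminus\{s\})\cup\{r\}$ is also a minimal resolving set. *)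

theory Defs
  imports "Graph_Theory.Graph_Theory" "HOL-Library.Cardinality" "HOL-Library.FuncSet"
begin

text \<open>
  Following \<^theory>\<open>Graph_Theory.Pair_Digraph\<close>, a finite simple graph is a \<^locale>\<open>pair_graph\<close>: each
  undirected edge is represented by its two opposite arcs. The definitions below are meant for
  finite simple connected graphs.
\<close>

text \<open>In \<^const>\<open>pre_digraph.apath\<close> a path is given by its list of arcs, so \<^const>\<open>length\<close> counts edges.
  The minimum exists whenever \<open>u\<close> and \<open>v\<close> are connected.\<close>

definition graph_dist :: "'a pair_pre_digraph \<Rightarrow> 'a \<Rightarrow> 'a \<Rightarrow> nat" where
  "graph_dist G u v = (LEAST k. \<exists>p. pre_digraph.apath (with_proj G) u p v \<and> length p = k)"

text \<open>The tuple \<open>r(v|W)\<close> is indexed by the elements of \<open>W\<close> themselves instead of by an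
  enumeration of \<open>W\<close>.\<close>

definition metric_representation :: "'a pair_pre_digraph \<Rightarrow> 'a set \<Rightarrow> 'a \<Rightarrow> ('a \<Rightarrow> nat)" where
  "metric_representation G W v = (\<lambda>w\<in>W. graph_dist G v w)"

definition resolving_set :: "'a pair_pre_digraph \<Rightarrow> 'a set \<Rightarrow> bool" where
  "resolving_set G W \<longleftrightarrow> W \<subseteq> pverts G \<and> inj_on (metric_representation G W) (pverts G)"

definition minimal_resolving_set :: "'a pair_pre_digraph \<Rightarrow> 'a set \<Rightarrow> bool" where
  "minimal_resolving_set G W \<longleftrightarrow>
     resolving_set G W \<and> \<not> (\<exists>U. U \<subset> W \<and> card U = card W - 1 \<and> resolving_set G U)"

definition exchange_property :: "'a pair_pre_digraph \<Rightarrow> bool" where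
  "exchange_property G \<longleftrightarrow>
     (\<forall>W1 W2 r. minimal_resolving_set G W1 \<and> minimal_resolving_set G W2 \<and> r \<in> W1 \<longrightarrow>
        (\<exists>s\<in>W2. minimal_resolving_set G ((W2 - {s}) \<union> {r})))"

text \<open>The vector space is the whole type \<open>'v\<close> with scalar multiplication \<open>scale\<close>, and \<open>B\<close> is a basis.\<close>

definition nonzero_component_graph ::
    "('f::field \<Rightarrow> 'v::ab_group_add \<Rightarrow> 'v) \<Rightarrow> 'v set \<Rightarrow> 'v pair_pre_digraph" where
  "nonzero_component_graph scale B =
     \<lparr> pverts = UNIV - {0},
       parcs = {(u, v). u \<noteq> 0 \<and> v \<noteq> 0 \<and> u \<noteq> v \<and>
                 (\<exists>b\<in>B. module.representation scale B u b \<noteq> 0 \<and>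
                         module.representation scale B v b \<noteq> 0)} \<rparr>"

lemma pair_graph_nonzero_component_graph:
  fixes scale :: "'f::{field,finite} \<Rightarrow> 'v::ab_group_add \<Rightarrow> 'v"
  assumes "finite_dimensional_vector_space scale B"
  shows "pair_graph (nonzero_component_graph scale B)"
proof -
  interpret V: finite_dimensional_vector_space scale B by fact
  have "UNIV \<subseteq> (\<lambda>f. \<Sum>b\<in>B. scale (f b) b) ` (B \<rightarrow>\<^sub>E (UNIV :: 'f set))"
  proof
    fix v :: 'v
    have "v \<in> V.span B" using V.span_Basis by simp
    then obtain f where f: "v = (\<Sum>b\<in>B. scale (f b) b)"
      using V.span_finite[OF V.finite_Basis] by auto
    have "v = (\<Sum>b\<in>B. scale (restrict f B b) b)" unfolding f by (rule sum.cong) auto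
    moreover have "restrict f B \<in> B \<rightarrow>\<^sub>E (UNIV :: 'f set)" by auto
    ultimately show "v \<in> (\<lambda>f. \<Sum>b\<in>B. scale (f b) b) ` (B \<rightarrow>\<^sub>E (UNIV :: 'f set))" by blast
  qed
  then have fin: "finite (UNIV :: 'v set)"
    by (rule finite_subset) (simp add: finite_PiE V.finite_Basis)
  then have "finite (UNIV :: ('v \<times> 'v) set)" by (simp add: finite_prod)
  then have "finite (A :: ('v \<times> 'v) set)" for A by (rule finite_subset[rotated]) simp
  with fin show ?thesis
    by unfold_locales
      (auto simp: nonzero_component_graph_def symmetric_def sym_def intro: finite_subset)
qed

lemma connected_nonzero_component_graph:
  fixes scale :: "'f::{field,finite} \<Rightarrow> 'v::ab_group_add \<Rightarrow> 'v"
  assumes "finite_dimensional_vector_space scale B" and "B \<noteq> {}"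
  shows "connected (with_proj (nonzero_component_graph scale B))"
proof -
  interpret V: finite_dimensional_vector_space scale B by fact
  let ?G = "nonzero_component_graph scale B"
  interpret G: pair_graph ?G by (rule pair_graph_nonzero_component_graph[OF assms(1)])
  have rep_nz: "\<exists>b\<in>B. V.representation B v b \<noteq> 0" if "v \<noteq> 0" for v
  proof (rule ccontr)
    assume "\<not> ?thesis"
    then have z: "\<forall>b\<in>B. V.representation B v b = 0" by simp
    have "(\<Sum>b\<in>B. scale (V.representation B v b) b) = v"
      by (rule V.sum_representation_eq[OF V.independent_Basis])
        (auto simp: V.span_Basis V.finite_Basis)
    with z that show False by simp
  qed
  define w where "w = (\<Sum>b\<in>B. b)"
  have rep_w: "V.representation B w b = 1" if "b \<in> B" for b
  proof -
    have "V.representation B w b = (\<Sum>c\<in>B. V.representation B c b)"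
      unfolding w_def by (subst V.representation_sum) (auto simp: V.independent_Basis V.span_Basis)
    also have "\<dots> = (\<Sum>c\<in>B. if c = b then 1 else 0)"
      by (rule sum.cong) (auto simp: V.representation_basis V.independent_Basis)
    finally show ?thesis using that V.finite_Basis by simp
  qed
  have w0: "w \<noteq> 0" using rep_w assms(2) by (auto simp: V.representation_zero)
  have arc: "(v, w) \<in> parcs ?G" "(w, v) \<in> parcs ?G" if "v \<noteq> 0" "v \<noteq> w" for v
    using rep_nz[OF that(1)] that w0 rep_w by (auto simp: nonzero_component_graph_def)
  have verts: "v \<in> pverts ?G \<longleftrightarrow> v \<noteq> 0" for v by (simp add: nonzero_component_graph_def)
  have to_w: "v \<rightarrow>\<^sup>*\<^bsub>with_proj ?G\<^esub> w" "w \<rightarrow>\<^sup>*\<^bsub>with_proj ?G\<^esub> v" if "v \<noteq> 0" for v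
    using arc[of v] that verts
    by (cases "v = w"; force intro: G.reachable_adjI G.reachable_refl)+
  have "strongly_connected (with_proj ?G)"
  proof (unfold strongly_connected_def, intro conjI ballI)
    show "verts (with_proj ?G) \<noteq> {}" using w0 verts by auto
    show "u \<rightarrow>\<^sup>*\<^bsub>with_proj ?G\<^esub> v"
      if "u \<in> verts (with_proj ?G)" "v \<in> verts (with_proj ?G)" for u v
      using that to_w[of u] to_w[of v] verts G.reachable_trans[of u w v] by simp
  qed
  then show ?thesis
    by (auto simp: connected_def strongly_connected_def intro!: G.reachable_mk_symmetricI)
qed

end

theory Submission
  imports Defs
begin

text \<open>
  For \<open>q = 2\<close> the vertices are the nonempty subsets of the basis \<open>B\<close>, and two of them are at
  distance 0, 1 or 2 according to whether they are equal, meet, or are disjoint. Hence a family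
  \<open>F\<close> is resolving iff any two distinct nonempty sets outside \<open>F\<close> are told apart by a member of
  \<open>F\<close> that meets exactly one of them.

  The set \<open>B\<close> itself meets everything, so it only tells itself from the rest. Still it lies in some
  minimal resolving family: for \<open>x \<in> B\<close>, the family of all sets other than \<open>B - {x}\<close> and \<open>{x}\<close> is
  resolving, but without \<open>B\<close> it no longer tells \<open>B\<close> from \<open>B - {x}\<close>. On the other hand, there is a
  resolving family in which no member can be replaced by \<open>B\<close>: the singletons if \<open>n \<ge> 4\<close>, and
  \<open>{a}, {a, b}, {a, c}\<close> if \<open>n = 3\<close>.
\<close>

section \<open>Resolving families of sets\<close>

definition nonempty_subsets :: "'a set \<Rightarrow> 'a set set" where
  "nonempty_subsets X = Pow X - {{}}"

definition resolving_family :: "'a set \<Rightarrow> 'a set set \<Rightarrow> bool" where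
  "resolving_family X F \<longleftrightarrow> F \<subseteq> nonempty_subsets X \<and>
     (\<forall>A\<in>nonempty_subsets X - F. \<forall>C\<in>nonempty_subsets X - F.
        A \<noteq> C \<longrightarrow> (\<exists>T\<in>F. (A \<inter> T = {}) \<noteq> (C \<inter> T = {})))"

text \<open>Single deletions suffice for minimality under inclusion, because enlarging a resolving
  family keeps it resolving.\<close>

definition minimal_resolving_family :: "'a set \<Rightarrow> 'a set set \<Rightarrow> bool" where
  "minimal_resolving_family X F \<longleftrightarrow>
     resolving_family X F \<and> (\<forall>A\<in>F. \<not> resolving_family X (F - {A}))"

lemma finite_nonempty_subsets: "finite X \<Longrightarrow> finite (nonempty_subsets X)"
  by (simp add: nonempty_subsets_def)

lemma not_resolving_familyI:
  assumes "A \<subseteq> X" "A \<noteq> {}" "A \<notin> F" "C \<subseteq> X" "C \<noteq> {}" "C \<notin> F" "A \<noteq> C"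
    and "\<And>T. T \<in> F \<Longrightarrow> (A \<inter> T = {}) = (C \<inter> T = {})"
  shows "\<not> resolving_family X F"
proof
  assume "resolving_family X F"
  moreover have "A \<in> nonempty_subsets X - F" "C \<in> nonempty_subsets X - F"
    using assms by (simp_all add: nonempty_subsets_def)
  ultimately obtain T where "T \<in> F" "(A \<inter> T = {}) \<noteq> (C \<inter> T = {})"
    using \<open>A \<noteq> C\<close> unfolding resolving_family_def by meson
  with assms(8) show False by simp
qed

text \<open>A larger family leaves fewer pairs to tell apart and keeps every member that tells them
  apart.\<close>

lemma resolving_family_mono:
  assumes "resolving_family X F" "F \<subseteq> F'" "F' \<subseteq> nonempty_subsets X"
  shows "resolving_family X F'"
  using assms unfolding resolving_family_def by blast

lemma minimal_resolving_subfamily: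
  assumes "finite X" "resolving_family X F"
  obtains M where "M \<subseteq> F" "minimal_resolving_family X M"
proof -
  let ?R = "{M. M \<subseteq> F \<and> resolving_family X M}"
  have "finite F"
    using assms finite_subset finite_nonempty_subsets by (auto simp: resolving_family_def)
  then have "finite ?R" by simp
  then obtain M where M: "M \<in> ?R" and min: "\<forall>M'\<in>?R. M' \<subseteq> M \<longrightarrow> M = M'"
    using finite_has_minimal2[of ?R F] assms(2) by blast
  have "\<not> resolving_family X (M - {A})" if "A \<in> M" for A
    using bspec[OF min, of "M - {A}"] M that by auto
  with M show thesis by (intro that[of M]) (simp_all add: minimal_resolving_family_def)
qed

lemma minimal_resolving_family_containing_top:
  assumes "finite X" "3 \<le> card X"
  obtains M where "minimal_resolving_family X M" "X \<in> M"
proof -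
  obtain Y where "Y \<subseteq> X" "card Y = 3"
    using assms by (meson obtain_subset_with_card_n)
  then obtain x y z where xyz: "{x, y, z} \<subseteq> X" "x \<noteq> y" "x \<noteq> z" "y \<noteq> z"
    by (auto simp: card_3_iff)
  define F where "F = nonempty_subsets X - {X - {x}, {x}}"
  \<comment> \<open>The third point z ensures that {y} is not X - {x}. So {y} stays in
    \<open>F\<close>, where it separates the only two sets left out.\<close>
  have "z \<in> X - {x}" "z \<notin> {y}" using xyz by auto
  then have "{y} \<noteq> X - {x}" by metis
  then have "{y} \<in> F" using xyz by (auto simp: F_def nonempty_subsets_def)
  moreover have "((X - {x}) \<inter> {y} = {}) \<noteq> ({x} \<inter> {y} = {})" using xyz by auto
  moreover have "A = X - {x} \<or> A = {x}" if "A \<in> nonempty_subsets X - F" for A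
    using that by (auto simp: F_def)
  moreover have "F \<subseteq> nonempty_subsets X" by (auto simp: F_def)
  ultimately have res: "resolving_family X F"
    unfolding resolving_family_def by (intro conjI ballI impI) metis+
  obtain M where M: "M \<subseteq> F" "minimal_resolving_family X M"
    using minimal_resolving_subfamily[OF assms(1) res] .
  \<comment> \<open>A nonempty subset of X missing X - {x} can only be {x}, which \<open>F\<close>
    lacks. So X and X - {x} both meet every member.\<close>
  have "\<not> resolving_family X (F - {X})"
  proof (rule not_resolving_familyI[of X _ _ "X - {x}"])
    show "(X \<inter> T = {}) = ((X - {x}) \<inter> T = {})" if "T \<in> F - {X}" for T
      using that unfolding F_def nonempty_subsets_def by blast
  qed (use xyz in \<open>auto simp: F_def\<close>)
  \<comment> \<open>Otherwise M would lie inside \<open>F - {X}\<close>, making that family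
    resolving.\<close>
  then have "X \<in> M"
    using resolving_family_mono[of X M "F - {X}"] M
    by (auto simp: minimal_resolving_family_def F_def)
  with M that show thesis by blast
qed

lemma resolving_family_singletons: "resolving_family X ((\<lambda>x. {x}) ` X)"
  unfolding resolving_family_def
proof (intro conjI ballI impI)
  show "(\<lambda>x. {x}) ` X \<subseteq> nonempty_subsets X" by (auto simp: nonempty_subsets_def)
  fix A C
  assume AC: "A \<in> nonempty_subsets X - (\<lambda>x. {x}) ` X"
    "C \<in> nonempty_subsets X - (\<lambda>x. {x}) ` X" "A \<noteq> C"
  then obtain x where "(x \<in> A) \<noteq> (x \<in> C)" by blast
  then have "x \<in> X" "(A \<inter> {x} = {}) \<noteq> (C \<inter> {x} = {})"
    using AC by (auto simp: nonempty_subsets_def)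
  then show "\<exists>T\<in>(\<lambda>x. {x}) ` X. (A \<inter> T = {}) \<noteq> (C \<inter> T = {})" by blast
qed

text \<open>Three points need their own family: for X = {a, b, c}, the family {b}, {c}, X still
  tells {a}, {a, b}, {a, c}, {b, c} apart, so the singletons allow the exchange.\<close>

lemma resolving_family_no_exchange_top:
  assumes "finite X" "3 \<le> card X"
  obtains F where "resolving_family X F"
    "\<And>A. A \<in> F \<Longrightarrow> \<not> resolving_family X (F - {A} \<union> {X})"
proof (cases "card X = 3")
  case True
  then obtain a b c where X: "X = {a, b, c}" and d: "a \<noteq> b" "a \<noteq> c" "b \<noteq> c"
    by (auto simp: card_3_iff)
  \<comment> \<open>With 1 for meeting a member and 0 for missing it, the outside sets {b}, {c}, {b,
    c}, X have the distinct patterns 010, 001, 011, 111.\<close>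
  let ?F = "{{a}, {a, b}, {a, c}}"
  have "resolving_family X ?F"
    unfolding resolving_family_def
  proof (intro conjI ballI impI)
    show "?F \<subseteq> nonempty_subsets X" by (simp add: X nonempty_subsets_def)
    fix A C assume AC: "A \<in> nonempty_subsets X - ?F" "C \<in> nonempty_subsets X - ?F" "A \<noteq> C"
    have "Pow X = {{}, {a}, {b}, {c}, {a, b}, {a, c}, {b, c}, {a, b, c}}"
      by (simp add: X Pow_insert insert_commute)
    then have outside: "nonempty_subsets X - ?F \<subseteq> {{b}, {c}, {b, c}, {a, b, c}}"
      by (simp add: nonempty_subsets_def, blast)
    from subsetD[OF outside AC(1)] subsetD[OF outside AC(2)]
    show "\<exists>T\<in>?F. (A \<inter> T = {}) \<noteq> (C \<inter> T = {})"
      using d AC(3) by (elim insertE emptyE; simp)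
  qed
  moreover have "\<not> resolving_family X (?F - {A} \<union> {X})" if A: "A \<in> ?F" for A
  proof -
    \<comment> \<open>Each removal frees a confused pair: without {a}, both {a} and {b, c} meet all
      members; without {a, b}, the sets {c} and {b, c} miss only {a}; without {a, c}, so do {b} and
      {b, c}.\<close>
    consider "A = {a}" | "A = {a, b}" | "A = {a, c}" using A by auto
    then show ?thesis
    proof cases
      case 1
      then show ?thesis
        by (intro not_resolving_familyI[of "{a}" _ _ "{b, c}"])
          (use d in \<open>auto simp: X doubleton_eq_iff\<close>)
    next
      case 2
      then show ?thesis
        by (intro not_resolving_familyI[of "{c}" _ _ "{b, c}"])
          (use d in \<open>auto simp: X doubleton_eq_iff\<close>)
    next
      case 3
      then show ?thesis
        by (intro not_resolving_familyI[of "{b}" _ _ "{b, c}"])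
          (use d in \<open>auto simp: X doubleton_eq_iff\<close>)
    qed
  qed
  ultimately show thesis by (rule that)
next
  case False
  let ?F = "(\<lambda>x. {x}) ` X"
  have "\<not> resolving_family X (?F - {A} \<union> {X})" if A: "A \<in> ?F" for A
  proof -
    obtain s where s: "s \<in> X" "A = {s}" using A by auto
    have "3 \<le> card (X - {s})" using assms False s by simp
    then obtain Y where "Y \<subseteq> X - {s}" "card Y = 3"
      by (meson obtain_subset_with_card_n)
    then obtain a c d where acd: "{a, c, d} \<subseteq> X - {s}" "a \<noteq> c" "a \<noteq> d" "c \<noteq> d"
      by (auto simp: card_3_iff)
    show ?thesis
    \<comment> \<open>The two sets differ only in s, so among singletons only the removed {s}
      separates them, and X meets both.\<close>
    proof (rule not_resolving_familyI[of "{a, c}" _ _ "{a, c, s}"])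
      \<comment> \<open>The fourth point d keeps both sets different from the new member X.\<close>
      have d: "d \<in> X" "d \<notin> {a, c}" "d \<notin> {a, c, s}" using acd by auto
      have "s \<in> {a, c, s}" "s \<notin> {a, c}" using acd by auto
      then show "{a, c} \<noteq> {a, c, s}" by metis
      have "{a, c} \<noteq> {x}" "{a, c, s} \<noteq> {x}" for x using acd(2) by (metis insertI1 insertI2 singletonD)+
      moreover have "{a, c} \<noteq> X" "{a, c, s} \<noteq> X" using d by metis+
      ultimately show "{a, c} \<notin> ?F - {A} \<union> {X}" "{a, c, s} \<notin> ?F - {A} \<union> {X}" by blast+
      show "({a, c} \<inter> T = {}) = ({a, c, s} \<inter> T = {})" if "T \<in> ?F - {A} \<union> {X}" for T
      proof (cases "T = X")
        case True
        then show ?thesis using acd by simp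
      next
        case False
        then obtain x where "T = {x}" "x \<noteq> s" using \<open>T \<in> ?F - {A} \<union> {X}\<close> s by auto
        then show ?thesis by simp
      qed
      show "{a, c} \<subseteq> X" "{a, c, s} \<subseteq> X" using acd s by auto
    qed simp_all
  qed
  then show thesis by (rule that[OF resolving_family_singletons])
qed

section \<open>Distances in the component graph\<close>

text \<open>Paths of length 0 and 1 amount to equality and adjacency; otherwise a common neighbour
  attains the lower bound 2.\<close>

lemma (in pair_graph) graph_dist_eq_if_diameter_le_2:
  assumes "u \<in> pverts G" "v \<in> pverts G"
    and "u \<noteq> v \<Longrightarrow> (u, v) \<notin> parcs G \<Longrightarrow> \<exists>w. (u, w) \<in> parcs G \<and> (w, v) \<in> parcs G"
  shows "graph_dist G u v = (if u = v then 0 else if (u, v) \<in> parcs G then 1 else 2)"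
proof -
  have zero: "(\<exists>p. apath u p v \<and> length p = 0) \<longleftrightarrow> u = v"
    using assms by (auto simp: apath_simps)
  have one: "(\<exists>p. apath u p v \<and> length p = 1) \<longleftrightarrow> u \<noteq> v \<and> (u, v) \<in> parcs G"
  proof
    assume "u \<noteq> v \<and> (u, v) \<in> parcs G"
    then have "apath u [(u, v)] v" using assms by (simp add: apath_simps)
    then show "\<exists>p. apath u p v \<and> length p = 1" by force
  qed (auto simp: apath_simps length_Suc_conv)
  have two: "\<exists>p. apath u p v \<and> length p = 2" if uv: "u \<noteq> v" "(u, v) \<notin> parcs G"
  proof -
    obtain w where w: "(u, w) \<in> parcs G" "(w, v) \<in> parcs G" using assms(3) uv by blast
    then have "u \<noteq> w" "w \<noteq> v" using no_loops' by auto
    with w uv have "apath u [(u, w), (w, v)] v"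
      using assms by (auto simp: apath_simps)
    then show ?thesis by force
  qed
  have ge2: "2 \<le> k"
    if "u \<noteq> v" "(u, v) \<notin> parcs G" "\<exists>p. apath u p v \<and> length p = k" for k
    using that zero one by (cases k; cases "k - 1") auto
  show ?thesis
    unfolding graph_dist_def
  proof (cases "u = v")
    case True
    then show "(LEAST k. \<exists>p. apath u p v \<and> length p = k) = (if u = v then 0 else if (u, v) \<in> parcs G then 1 else 2)"
      using zero by (auto intro!: Least_equality)
  next
    case False
    have "1 \<le> k" if "\<exists>p. apath u p v \<and> length p = k" for k
      using that zero False by (cases k) auto
    then show "(LEAST k. \<exists>p. apath u p v \<and> length p = k) = (if u = v then 0 else if (u, v) \<in> parcs G then 1 else 2)"
      using False one two ge2 by (auto intro!: Least_equality)
  qed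
qed

text \<open>Isolates the combinatorics: \<open>vertex\<close> identifies the graph with the
  intersection graph of the nonempty subsets of X. Linear algebra is needed only to instantiate
  it.\<close>

locale set_intersection_graph = pair_graph G for G :: "'a pair_pre_digraph" +
  fixes X :: "'b set" and vertex :: "'b set \<Rightarrow> 'a"
  assumes finite_ground: "finite X"
    and inj_vertex: "inj_on vertex (nonempty_subsets X)"
    and pverts_eq: "pverts G = vertex ` nonempty_subsets X"
    and arc_iff: "\<And>A C. A \<in> nonempty_subsets X \<Longrightarrow> C \<in> nonempty_subsets X \<Longrightarrow>
      (vertex A, vertex C) \<in> parcs G \<longleftrightarrow> A \<noteq> C \<and> A \<inter> C \<noteq> {}"
begin

lemma vertex_eq_iff:
  "A \<in> nonempty_subsets X \<Longrightarrow> C \<in> nonempty_subsets X \<Longrightarrow> vertex A = vertex C \<longleftrightarrow> A = C"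
  by (rule inj_on_eq_iff[OF inj_vertex])

text \<open>Disjoint nonempty A and C have the common neighbour A \<union> C, which differs from
  both.\<close>

lemma graph_dist_vertex:
  assumes "A \<in> nonempty_subsets X" "C \<in> nonempty_subsets X"
  shows "graph_dist G (vertex A) (vertex C) = (if A = C then 0 else if A \<inter> C \<noteq> {} then 1 else 2)"
proof -
  have "\<exists>w. (vertex A, w) \<in> parcs G \<and> (w, vertex C) \<in> parcs G" if "A \<inter> C = {}"
  proof -
    have "A \<union> C \<in> nonempty_subsets X" using assms by (auto simp: nonempty_subsets_def)
    moreover have "A \<noteq> A \<union> C" "A \<inter> (A \<union> C) \<noteq> {}" "A \<union> C \<noteq> C" "(A \<union> C) \<inter> C \<noteq> {}"
      using assms that by (auto simp: nonempty_subsets_def)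
    ultimately show ?thesis
      using assms arc_iff[of A "A \<union> C"] arc_iff[of "A \<union> C" C]
      by (intro exI[of _ "vertex (A \<union> C)"]) simp
  qed
  then show ?thesis
    using graph_dist_eq_if_diameter_le_2[of "vertex A" "vertex C"] assms
    by (auto simp: pverts_eq arc_iff vertex_eq_iff)
qed

lemma resolving_set_vertex_image_iff:
  assumes F: "F \<subseteq> nonempty_subsets X"
  shows "resolving_set G (vertex ` F) \<longleftrightarrow> resolving_family X F"
proof
  assume res: "resolving_set G (vertex ` F)"
  have "\<exists>T\<in>F. (A \<inter> T = {}) \<noteq> (C \<inter> T = {})"
    if AC: "A \<in> nonempty_subsets X - F" "C \<in> nonempty_subsets X - F" "A \<noteq> C" for A C
  proof (rule ccontr)
    assume no: "\<not> ?thesis"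
    \<comment> \<open>As A and C lie outside F, neither equals T, so both distances are 1 or 2 and
      depend only on meeting T.\<close>
    have "graph_dist G (vertex A) (vertex T) = graph_dist G (vertex C) (vertex T)"
      if "T \<in> F" for T
      using that AC F no by (subst (1 2) graph_dist_vertex) auto
    then have "metric_representation G (vertex ` F) (vertex A) =
        metric_representation G (vertex ` F) (vertex C)"
      by (auto simp: metric_representation_def fun_eq_iff restrict_def)
    then have "vertex A = vertex C"
      using res AC by (auto simp: resolving_set_def pverts_eq dest!: inj_onD)
    then show False using AC vertex_eq_iff by auto
  qed
  then show "resolving_family X F" using F by (auto simp: resolving_family_def)
next
  assume res: "resolving_family X F"
  have "A = C"
    if AC: "A \<in> nonempty_subsets X" "C \<in> nonempty_subsets X"
      and eq: "metric_representation G (vertex ` F) (vertex A) =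
        metric_representation G (vertex ` F) (vertex C)" for A C
  proof (rule ccontr)
    assume "A \<noteq> C"
    have dist: "graph_dist G (vertex A) (vertex T) = graph_dist G (vertex C) (vertex T)"
      if "T \<in> F" for T
      using fun_cong[OF eq, of "vertex T"] that by (simp add: metric_representation_def)
    \<comment> \<open>If A were in F, its own coordinate would be 0 for A and positive for
      C.\<close>
    have "A \<notin> F" using dist[of A] AC \<open>A \<noteq> C\<close> by (auto simp: graph_dist_vertex split: if_splits)
    moreover have "C \<notin> F" using dist[of C] AC \<open>A \<noteq> C\<close> by (auto simp: graph_dist_vertex split: if_splits)
    ultimately obtain T where T: "T \<in> F" "(A \<inter> T = {}) \<noteq> (C \<inter> T = {})"
      using res AC \<open>A \<noteq> C\<close> unfolding resolving_family_def by blast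
    moreover have "T \<noteq> A" "T \<noteq> C" "T \<in> nonempty_subsets X"
      using T(1) \<open>A \<notin> F\<close> \<open>C \<notin> F\<close> F by auto
    ultimately show False using dist[of T] AC by (auto simp: graph_dist_vertex split: if_splits)
  qed
  then show "resolving_set G (vertex ` F)"
    using F unfolding resolving_set_def pverts_eq by (blast intro: inj_onI)
qed

lemma minimal_resolving_set_vertex_image:
  assumes min: "minimal_resolving_family X F"
  shows "minimal_resolving_set G (vertex ` F)"
proof -
  have res: "resolving_family X F" and F: "F \<subseteq> nonempty_subsets X"
    using min by (auto simp: minimal_resolving_family_def resolving_family_def)
  \<comment> \<open>This excludes all proper subsets, hence those with one element fewer: a preimage
    of U avoids some A in F, so monotonicity would make \<open>F - {A}\<close> resolving.\<close>
  have "\<not> resolving_set G U" if U: "U \<subset> vertex ` F" for U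
  proof
    assume "resolving_set G U"
    moreover obtain F' where F': "F' \<subseteq> F" "U = vertex ` F'"
      using U by (metis psubset_imp_subset subset_imageE)
    ultimately have "resolving_family X F'"
      using resolving_set_vertex_image_iff[of F'] F by simp
    moreover obtain A where "A \<in> F" "A \<notin> F'" using U F' by blast
    moreover have "F' \<subseteq> F - {A}" "F - {A} \<subseteq> nonempty_subsets X"
      using F F' \<open>A \<notin> F'\<close> by auto
    ultimately have "resolving_family X (F - {A})"
      using resolving_family_mono by metis
    then show False using min \<open>A \<in> F\<close> by (auto simp: minimal_resolving_family_def)
  qed
  moreover have "resolving_set G (vertex ` F)"
    using res by (simp add: resolving_set_vertex_image_iff[OF F])
  ultimately show ?thesis unfolding minimal_resolving_set_def by metis
qed

lemma not_exchange_property: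
  assumes "3 \<le> card X"
  shows "\<not> exchange_property G"
proof
  assume ex: "exchange_property G"
  obtain M where M: "minimal_resolving_family X M" "X \<in> M"
    using minimal_resolving_family_containing_top[OF finite_ground assms] by blast
  obtain F where F: "resolving_family X F"
    and no: "\<And>A. A \<in> F \<Longrightarrow> \<not> resolving_family X (F - {A} \<union> {X})"
    using resolving_family_no_exchange_top[OF finite_ground assms] by blast
  have X: "X \<in> nonempty_subsets X" and FX: "F \<subseteq> nonempty_subsets X"
    using M F by (auto simp: minimal_resolving_family_def resolving_family_def)
  \<comment> \<open>Minimality of F comes for free: if \<open>F - {A}\<close> were resolving, adding
    X would keep it so, against \<open>no\<close>.\<close>
  have "\<not> resolving_family X (F - {A})" if "A \<in> F" for A
    using no[OF that] resolving_family_mono[of X "F - {A}" "F - {A} \<union> {X}"] X FX by blast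
  then have "minimal_resolving_family X F" using F by (simp add: minimal_resolving_family_def)
  then have "minimal_resolving_set G (vertex ` M)" "minimal_resolving_set G (vertex ` F)"
      "vertex X \<in> vertex ` M"
    using M minimal_resolving_set_vertex_image by simp_all
  \<comment> \<open>The exchange property is applied to the images of M and F, with
    \<open>vertex X\<close> as the element to be moved into the latter.\<close>
  then obtain s where s: "s \<in> vertex ` F"
    "minimal_resolving_set G (vertex ` F - {s} \<union> {vertex X})"
    using ex unfolding exchange_property_def by blast
  then obtain A where A: "A \<in> F"
    "minimal_resolving_set G (vertex ` F - {vertex A} \<union> {vertex X})"
    by auto
  have "vertex ` F - {vertex A} \<union> {vertex X} = vertex ` (F - {A} \<union> {X})"
    using A(1) FX vertex_eq_iff by (auto simp: subset_iff)
  then have "resolving_family X (F - {A} \<union> {X})"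
    using A(2) X FX resolving_set_vertex_image_iff[of "F - {A} \<union> {X}"]
    by (auto simp: minimal_resolving_set_def)
  then show False using no A(1) by blast
qed

end

section \<open>Vectors over the field with two elements as subsets of the basis\<close>

lemma card_2_nonzero_eq_1:
  fixes x :: "'f::field"
  assumes "CARD('f) = 2" "x \<noteq> 0"
  shows "x = 1"
proof (rule ccontr)
  assume "x \<noteq> 1"
  then have "card {0, 1, x} = 3" using assms(2) by simp
  moreover have "finite (UNIV :: 'f set)" using assms(1) by (simp add: card_ge_0_finite)
  ultimately show False using card_mono[of "UNIV :: 'f set" "{0, 1, x}"] assms(1) by simp
qed

context finite_dimensional_vector_space
begin

lemma representation_sum_basis:
  assumes "A \<subseteq> Basis"
  shows "representation Basis (\<Sum>A) b = (if b \<in> A then 1 else 0)"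
proof -
  have "representation Basis (\<Sum>A) b = (\<Sum>c\<in>A. representation Basis c b)"
    by (subst representation_sum) (auto simp: independent_Basis span_Basis)
  also have "\<dots> = (\<Sum>c\<in>A. if c = b then 1 else 0)"
    using assms by (intro sum.cong) (auto simp: representation_basis independent_Basis)
  finally show ?thesis using finite_subset[OF assms finite_Basis] by simp
qed

lemma sum_representation_support_eq:
  assumes "CARD('a) = 2"
  shows "\<Sum>{b. representation Basis v b \<noteq> 0} = v"
proof -
  have "(\<Sum>b | representation Basis v b \<noteq> 0. scale (representation Basis v b) b) = v"
    by (rule sum_nonzero_representation_eq) (auto simp: independent_Basis span_Basis)
  moreover have "scale (representation Basis v b) b = b" if "representation Basis v b \<noteq> 0" for b
    using card_2_nonzero_eq_1[OF assms that] by simp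
  ultimately show ?thesis by simp
qed

end

text \<open>Summation and taking supports are mutually inverse between subsets of B and vectors, and
  a shared non-zero coefficient is a common point of the supports.\<close>

lemma set_intersection_graph_nonzero_component_graph:
  fixes scale :: "'f::{field,finite} \<Rightarrow> 'v::ab_group_add \<Rightarrow> 'v"
  assumes "finite_dimensional_vector_space scale B" "CARD('f) = 2"
  shows "set_intersection_graph (nonzero_component_graph scale B) B (\<lambda>A. \<Sum>A)"
proof -
  interpret V: finite_dimensional_vector_space scale B by fact
  interpret pair_graph "nonzero_component_graph scale B"
    by (rule pair_graph_nonzero_component_graph[OF assms(1)])
  have rep: "V.representation B (\<Sum>A) b \<noteq> 0 \<longleftrightarrow> b \<in> A" if "A \<in> nonempty_subsets B" for A b
    using that V.representation_sum_basis[of A b] by (auto simp: nonempty_subsets_def)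
  have eq: "A = C" if "A \<in> nonempty_subsets B" "C \<in> nonempty_subsets B" "\<Sum>A = \<Sum>C" for A C
    using rep[OF that(1)] rep[OF that(2)] that(3) by auto
  have nz: "\<Sum>A \<noteq> 0" if "A \<in> nonempty_subsets B" for A
    using rep[OF that] that by (auto simp: V.representation_zero nonempty_subsets_def)
  show ?thesis
  proof
    show "finite B" by (rule V.finite_Basis)
    show "inj_on (\<lambda>A. \<Sum>A) (nonempty_subsets B)" using eq by (auto intro: inj_onI)
    have "v \<in> (\<lambda>A. \<Sum>A) ` nonempty_subsets B" if "v \<noteq> 0" for v
    proof
      show "v = \<Sum>{b. V.representation B v b \<noteq> 0}"
        using V.sum_representation_support_eq[OF assms(2)] by simp
      \<comment> \<open>An empty support would make v the empty sum 0.\<close>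
      then show "{b. V.representation B v b \<noteq> 0} \<in> nonempty_subsets B"
        using that V.representation_ne_zero by (force simp: nonempty_subsets_def)
    qed
    then show "pverts (nonzero_component_graph scale B) = (\<lambda>A. \<Sum>A) ` nonempty_subsets B"
      using nz by (auto simp: nonzero_component_graph_def)
    show "(\<Sum>A, \<Sum>C) \<in> parcs (nonzero_component_graph scale B) \<longleftrightarrow> A \<noteq> C \<and> A \<inter> C \<noteq> {}"
      if "A \<in> nonempty_subsets B" "C \<in> nonempty_subsets B" for A C
    proof -
      have "(\<Sum>A, \<Sum>C) \<in> parcs (nonzero_component_graph scale B) \<longleftrightarrow>
          \<Sum>A \<noteq> \<Sum>C \<and> (\<exists>b\<in>B. b \<in> A \<and> b \<in> C)"
        using nz that by (simp add: nonzero_component_graph_def rep)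
      moreover have "\<Sum>A = \<Sum>C \<longleftrightarrow> A = C" using eq[OF that] by blast
      moreover have "(\<exists>b\<in>B. b \<in> A \<and> b \<in> C) \<longleftrightarrow> A \<inter> C \<noteq> {}"
        using that by (auto simp: nonempty_subsets_def)
      ultimately show ?thesis by simp
    qed
  qed
qed

theorem theorem3p5:
  fixes scale :: "'f::{field,finite} \<Rightarrow> 'v::ab_group_add \<Rightarrow> 'v"
    and B :: "'v set" and n q :: nat
  assumes "finite_dimensional_vector_space scale B"
    and "vector_space.dim scale (UNIV :: 'v set) = n"
    and "CARD('f) = q"
    and "q = 2" and "n \<ge> 3"
  shows "\<not> exchange_property (nonzero_component_graph scale B)"
proof -
  interpret V: finite_dimensional_vector_space scale B by fact
  have "3 \<le> card B" using assms(2,5) by (simp add: V.dim_UNIV)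
  moreover have "CARD('f) = 2" using assms(3,4) by simp
  ultimately show ?thesis
    using set_intersection_graph.not_exchange_property
      set_intersection_graph_nonzero_component_graph[OF assms(1)] by blast
qed

end
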